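(* Let $p$ be a prime, $q$ a power of $p$, $K=\mathbb{F}_q(T)$, and let $n,d$ be positive integers with $d\mid n$ and $p\nmid n$. Let $a\in K^\times\setminus\mathbb{F}_q$ and let $h$ be the largest integer $t\geq1$ such that $\tilde a\in(K^\times)^t$. Let $\mathbb{F}_{n,d}$ be the constant field of $K(\zeta_n,a^{1/d})$. Then \[ [K(\zeta_n,a^{1/d}):\mathbb{F}_{n,d}K]=\frac{d}{(d,h)}. \]
   Context: $\zeta_n\in\bar{\mathbb{F}}_q$ is a primitive $n$-th root of unity. For $f\in\mathbb{F}_q[T]$ nonzero, $\tilde f$ is the monic polynomial with $f=u\tilde f$, $u\in\mathbb{F}_q^\times$; for $a=f/g\in K^\times$, $\tilde a=\tilde f/\tilde g$. The constant field of a function field is the algebraic closure of $\mathbb{F}_q$ in it; $\mathbb{F}_{n,d}K$ is the compositum. *)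

theory Defs
  imports
    "HOL-Algebra.Algebraic_Closure_Type"
    "HOL-Algebra.Generated_Fields"
    "HOL-Algebra.Finite_Extensions"
begin

text \<open>
  The finite field is a type \<open>'q\<close> of sort \<open>{finite, field}\<close>, the rational function field is
  \<open>'q poly fract\<close>, and all extensions are subfields of its algebraic closure
  \<open>'q poly fract alg_closure\<close>, regarded as a ring in the sense of HOL-Algebra, so that
  generated subfields, algebraicity and the dimension over a subfield are the library's notions.
\<close>

abbreviation Kbar :: "'q::field poly fract alg_closure ring"
  where "Kbar \<equiv> ring_of_type_algebra"

definition const_fract :: "'q::field \<Rightarrow> 'q poly fract"
  where "const_fract c = to_fract [:c:]"

definition Fq :: "'q::field poly fract alg_closure set"
  where "Fq = range (\<lambda>c. to_ac (const_fract c))"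

definition Kq :: "'q::field poly fract alg_closure set"
  where "Kq = range to_ac"

definition adjoin :: "'q::field poly fract alg_closure set \<Rightarrow> 'q poly fract alg_closure set
    \<Rightarrow> 'q poly fract alg_closure set"
  where "adjoin E S = generate_field Kbar (E \<union> S)"

definition compositum :: "'q::field poly fract alg_closure set \<Rightarrow> 'q poly fract alg_closure set
    \<Rightarrow> 'q poly fract alg_closure set"
  where "compositum E F = generate_field Kbar (E \<union> F)"

definition constant_field :: "'q::field poly fract alg_closure set
    \<Rightarrow> 'q poly fract alg_closure set"
  where "constant_field L = {x \<in> L. ring.algebraic Kbar Fq x}"

definition primitive_root_of_unity :: "nat \<Rightarrow> 'a::field \<Rightarrow> bool"
  where "primitive_root_of_unity n z \<longleftrightarrow> n > 0 \<and> z ^ n = 1 \<and> (\<forall>m. 0 < m \<and> m < n \<longrightarrow> z ^ m \<noteq> 1)"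

definition monic_part :: "'q::field poly \<Rightarrow> 'q poly"
  where "monic_part f = smult (inverse (Polynomial.lead_coeff f)) f"

lemma monic_part_characterization:
  fixes f :: "'q::field poly"
  assumes "f \<noteq> 0"
  shows "Polynomial.lead_coeff (monic_part f) = 1"
    and "\<exists>u. u \<noteq> 0 \<and> f = smult u (monic_part f)"
proof -
  have "Polynomial.lead_coeff f \<noteq> 0" using assms by simp
  then show "Polynomial.lead_coeff (monic_part f) = 1"
    and "\<exists>u. u \<noteq> 0 \<and> f = smult u (monic_part f)"
    by (auto simp: monic_part_def intro!: exI[of _ "Polynomial.lead_coeff f"])
qed

lemma monic_part_mult: "monic_part (f * g) = monic_part f * monic_part (g :: 'q::field poly)"
  by (simp add: monic_part_def lead_coeff_mult mult.commute)

text \<open>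
  The value for \<open>Fract f g\<close> does not depend on the choice of the representing pair; see
  \<open>monic_fract_Fract\<close> below.
\<close>

definition monic_fract :: "'q::field poly fract \<Rightarrow> 'q poly fract"
  where "monic_fract a = (THE b. \<exists>f g. f \<noteq> 0 \<and> g \<noteq> 0 \<and> a = Fract f g \<and>
    b = Fract (monic_part f) (monic_part g))"

lemma monic_fract_Fract:
  fixes f g :: "'q::field poly"
  assumes "f \<noteq> 0" "g \<noteq> 0"
  shows "monic_fract (Fract f g) = Fract (monic_part f) (monic_part g)"
  unfolding monic_fract_def
proof (rule the_equality)
  show "\<exists>f' g'. f' \<noteq> 0 \<and> g' \<noteq> 0 \<and> Fract f g = Fract f' g' \<and>
    Fract (monic_part f) (monic_part g) = Fract (monic_part f') (monic_part g')"
    using assms by blast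
next
  fix b
  assume "\<exists>f' g'. f' \<noteq> 0 \<and> g' \<noteq> 0 \<and> Fract f g = Fract f' g' \<and>
    b = Fract (monic_part f') (monic_part g')"
  then obtain f' g' where *: "f' \<noteq> 0" "g' \<noteq> 0" "Fract f g = Fract f' g'"
    "b = Fract (monic_part f') (monic_part g')" by blast
  have nz: "monic_part h \<noteq> 0" if "h \<noteq> 0" for h :: "'q poly"
    using monic_part_characterization(1)[OF that] by auto
  have "f * g' = f' * g" using * assms by (simp add: eq_fract)
  then have "monic_part f * monic_part g' = monic_part f' * monic_part g"
    by (metis monic_part_mult)
  then show "b = Fract (monic_part f) (monic_part g)"
    using * assms nz by (simp add: eq_fract)
qed

text \<open>
  If \<open>a\<close> is not a constant, the exponents in question are bounded, so that the greatest one
  exists; \<open>GREATEST\<close> is unspecified otherwise.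
\<close>

definition power_index :: "'q::field poly fract \<Rightarrow> nat"
  where "power_index a = (GREATEST t. t \<ge> 1 \<and> (\<exists>c. c \<noteq> 0 \<and> monic_fract a = c ^ t))"

end

theory Submission
  imports Defs
begin

text \<open>
  All \<open>d\<close>-th roots of unity lie in \<open>F\<close>, and \<open>M = F(b)\<close>. As in Kummer theory, the constant
  coefficient of the minimal polynomial of \<open>b\<close> over \<open>F\<close>, of degree \<open>r\<close>, shows \<open>b ^ r \<in> F\<close>, hence
  \<open>b ^ m \<in> F\<close> for \<open>m = gcd r d\<close>, and \<open>a\<close> is the \<open>d / m\<close>-th power of an element of \<open>F\<close>, that is,
  of a quotient of polynomials in \<open>T\<close> with coefficients algebraic over the finite field. Taking
  numerator and denominator coprime and monic, unique factorization shows that they are fixed by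
  the Frobenius acting on coefficients, since \<open>a\<close> is. So \<open>d / m\<close> divides \<open>h\<close>, and
  \<open>d / gcd d h\<close> divides \<open>m\<close>. Conversely, \<open>b ^ (d / gcd d h)\<close> is the product of an element of \<open>K\<close>
  and a constant, so it lies in \<open>F\<close>.
\<close>

section \<open>Subfields and polynomials in a field type\<close>

lemma ring_of_type_algebra_simps [simp]:
  "carrier ring_of_type_algebra = (UNIV :: 'a::field set)"
  "monoid.mult ring_of_type_algebra = ((*) :: 'a \<Rightarrow> 'a \<Rightarrow> 'a)"
  "monoid.one ring_of_type_algebra = (1 :: 'a)"
  "ring.zero ring_of_type_algebra = (0 :: 'a)"
  "ring.add ring_of_type_algebra = ((+) :: 'a \<Rightarrow> 'a \<Rightarrow> 'a)"
  by (simp_all add: ring_of_type_algebra_def fun_eq_iff)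

context
begin

interpretation R: field "ring_of_type_algebra :: 'a::field ring"
  by (rule field_from_type_algebra)

lemma a_inv_ring_of_type_algebra [simp]: "a_inv ring_of_type_algebra x = - (x :: 'a::field)"
  using R.add.inv_equality[of "- x" x] by (simp add: a_inv_def)

lemma m_inv_ring_of_type_algebra [simp]:
  "x \<noteq> 0 \<Longrightarrow> m_inv ring_of_type_algebra x = inverse (x :: 'a::field)"
  using R.inv_char[of x "inverse x"] by simp

lemma nat_pow_ring_of_type_algebra [simp]:
  "x [^]\<^bsub>ring_of_type_algebra\<^esub> n = (x :: 'a::field) ^ (n :: nat)"
  by (induction n) (simp_all add: mult.commute)

lemma subfield_closed:
  assumes "subfield K (ring_of_type_algebra :: 'a::field ring)"
  shows "0 \<in> K" "1 \<in> K" "x \<in> K \<Longrightarrow> - x \<in> K" "x \<in> K \<Longrightarrow> y \<in> K \<Longrightarrow> x + y \<in> K"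
    "x \<in> K \<Longrightarrow> y \<in> K \<Longrightarrow> x * y \<in> K" "x \<in> K \<Longrightarrow> inverse x \<in> K" "x \<in> K \<Longrightarrow> x ^ n \<in> K"
    "x \<in> K \<Longrightarrow> y \<in> K \<Longrightarrow> x / y \<in> K"
proof -
  have sr: "subring K ring_of_type_algebra"
    using assms by (rule subfieldE(1))
  note c = subringE[OF sr]
  show zero: "0 \<in> K" and one: "1 \<in> K" and "x \<in> K \<Longrightarrow> - x \<in> K"
    and "x \<in> K \<Longrightarrow> y \<in> K \<Longrightarrow> x + y \<in> K"
    using c by auto
  have mult: "x * y \<in> K" if "x \<in> K" "y \<in> K" for x y
    using c(6)[OF that] by simp
  then show "x \<in> K \<Longrightarrow> y \<in> K \<Longrightarrow> x * y \<in> K" .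
  \<comment> \<open>The type's \<open>inverse\<close> sends 0 to 0, so closure under it is true at 0
    as well, where the ring inverse is unspecified.\<close>
  have inv: "inverse x \<in> K" if "x \<in> K" for x
    using R.subfield_m_inv(1)[OF assms, of x] that zero by (cases "x = 0") auto
  then show "x \<in> K \<Longrightarrow> inverse x \<in> K" .
  show "x \<in> K \<Longrightarrow> x ^ n \<in> K"
    by (induction n) (auto intro: one mult)
  show "x \<in> K \<Longrightarrow> y \<in> K \<Longrightarrow> x / y \<in> K"
    unfolding field_class.field_divide_inverse by (intro mult inv)
qed

lemma subfieldI_type:
  assumes "0 \<in> K" "1 \<in> K" "\<And>x. x \<in> K \<Longrightarrow> - x \<in> K" "\<And>x y. x \<in> K \<Longrightarrow> y \<in> K \<Longrightarrow> x + y \<in> K"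
    "\<And>x y. x \<in> K \<Longrightarrow> y \<in> K \<Longrightarrow> x * y \<in> K" "\<And>x. x \<in> K \<Longrightarrow> inverse x \<in> K"
  shows "subfield K (ring_of_type_algebra :: 'a::field ring)"
  by (rule R.subfieldI'[OF R.subringI]) (use assms in auto)

lemma subfield_generate_field:
  "subfield (generate_field ring_of_type_algebra S) (ring_of_type_algebra :: 'a::field ring)"
  by (rule R.generate_field_is_subfield) simp

lemma generate_field_least:
  assumes "subfield K (ring_of_type_algebra :: 'a::field ring)" "S \<subseteq> K"
  shows "generate_field ring_of_type_algebra S \<subseteq> K"
  using R.generate_field_min_subfield1[OF _ assms] by simp

text \<open>Ring polynomials are coefficient lists with the leading coefficient first, whereas
  \<open>Poly\<close> expects the constant term first; hence the reversal.\<close>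

lemma eval_eq_poly: "ring.eval ring_of_type_algebra cs x = poly (Poly (rev cs)) (x :: 'a::field)"
  by (induction cs) (auto simp: Poly_append poly_monom algebra_simps)

lemma mem_univ_poly_iff:
  "cs \<in> carrier (univ_poly (ring_of_type_algebra :: 'a::field ring) K) \<longleftrightarrow>
    set cs \<subseteq> K \<and> (cs \<noteq> [] \<longrightarrow> hd cs \<noteq> 0)"
  by (auto simp: univ_poly_def polynomial_def)

lemma rev_coeffs_mem_univ_poly:
  assumes "\<And>i. poly.coeff P i \<in> K"
  shows "rev (coeffs P) \<in> carrier (univ_poly (ring_of_type_algebra :: 'a::field ring) K)"
  unfolding mem_univ_poly_iff
  using assms by (auto simp: coeffs_def hd_rev)

lemma coeff_Poly_rev_mem:
  assumes "cs \<in> carrier (univ_poly (ring_of_type_algebra :: 'a::field ring) K)" "0 \<in> K"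
  shows "poly.coeff (Poly (rev cs)) i \<in> K"
  using assms nth_mem[of i "rev cs"] by (auto simp: mem_univ_poly_iff nth_default_def)

text \<open>A nonzero head leaves no trailing zeros after reversal, so \<open>Poly\<close> drops
  nothing and the length of the list gives the degree.\<close>

lemma Poly_rev_monic:
  assumes "cs \<noteq> []" "hd cs = (c :: 'a::field)" "c \<noteq> 0"
  shows "Polynomial.degree (Poly (rev cs)) = length cs - 1"
    "Polynomial.lead_coeff (Poly (rev cs)) = c"
proof -
  have "coeffs (Poly (rev cs)) = rev cs"
    using assms by (cases cs) (auto simp: no_trailing_unfold)
  then show d: "Polynomial.degree (Poly (rev cs)) = length cs - 1"
    by (simp add: degree_eq_length_coeffs)
  show "Polynomial.lead_coeff (Poly (rev cs)) = c"
    unfolding d using assms by (cases cs) (auto simp: nth_default_append)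
qed

lemma algebraic_iff_poly:
  assumes "subfield K (ring_of_type_algebra :: 'a::field ring)"
  shows "ring.algebraic ring_of_type_algebra K (x::'a::field) \<longleftrightarrow>
    (\<exists>P. P \<noteq> 0 \<and> (\<forall>i. poly.coeff P i \<in> K) \<and> poly P x = 0)"
proof
  assume "R.algebraic K x"
  then obtain cs where cs: "cs \<in> carrier (univ_poly ring_of_type_algebra K)" "cs \<noteq> []"
      "R.eval cs x = 0"
    using R.algebraicE[OF subfieldE(1)[OF assms], of x] by (auto simp: over_def)
  have "Poly (rev cs) \<noteq> 0"
    using Poly_rev_monic(2)[OF cs(2) refl] cs(1,2)
    by (metis leading_coeff_0_iff mem_univ_poly_iff)
  then show "\<exists>P. P \<noteq> 0 \<and> (\<forall>i. poly.coeff P i \<in> K) \<and> poly P x = 0"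
    using cs coeff_Poly_rev_mem[OF cs(1) subfield_closed(1)[OF assms]]
    by (auto simp: eval_eq_poly)
next
  assume "\<exists>P. P \<noteq> 0 \<and> (\<forall>i. poly.coeff P i \<in> K) \<and> poly P x = 0"
  then obtain P where "P \<noteq> 0" "\<And>i. poly.coeff P i \<in> K" "poly P x = 0"
    by blast
  then show "R.algebraic K x"
    using R.algebraicI[OF rev_coeffs_mem_univ_poly, of P K x]
    by (simp add: eval_eq_poly over_def)
qed

text \<open>The witness is \<open>R.Irr K x\<close> rewritten as a polynomial of the type. That it
  divides every polynomial over \<open>K\<close> vanishing at \<open>x\<close> is recorded through
  the two consequences needed later, on degrees and on roots.\<close>

lemma minimal_polynomial_dimension:
  assumes K: "subfield K (ring_of_type_algebra :: 'a::field ring)"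
    and "ring.algebraic ring_of_type_algebra K (x::'a)"
  obtains P where "Polynomial.lead_coeff P = 1" "\<forall>i. poly.coeff P i \<in> K" "poly P x = 0"
    "ring.dimension ring_of_type_algebra (Polynomial.degree P) K
      (generate_field ring_of_type_algebra (K \<union> {x}))"
    "\<forall>Q. Q \<noteq> 0 \<and> (\<forall>i. poly.coeff Q i \<in> K) \<and> poly Q x = 0 \<longrightarrow>
      Polynomial.degree P \<le> Polynomial.degree Q \<and> (\<forall>y. poly P y = 0 \<longrightarrow> poly Q y = 0)"
proof -
  have alg: "(R.algebraic over K) x" and x: "x \<in> carrier ring_of_type_algebra"
    using assms by (simp_all add: over_def)
  define cs where "cs = R.Irr K x"
  note irr = R.IrrE[OF K x alg, folded cs_def]
  have ne: "cs \<noteq> []"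
    using irr(2) R.pirreducibleE(1)[OF subfieldE(1)[OF K] irr(1)] by blast
  have hd: "hd cs = 1"
    using irr(3) ne by simp
  define P where "P = Poly (rev cs)"
  have deg: "Polynomial.degree P = length cs - 1" and "Polynomial.lead_coeff P = 1"
    unfolding P_def using Poly_rev_monic[OF ne hd] by simp_all
  moreover have "poly.coeff P i \<in> K" for i
    unfolding P_def using coeff_Poly_rev_mem[OF irr(1) subfield_closed(1)[OF K]] .
  moreover have "poly P x = 0"
    using irr(4) by (simp add: eval_eq_poly P_def)
  \<comment> \<open>The dimension formula is about the values at \<open>x\<close> of polynomials
    over \<open>K\<close>; as \<open>x\<close> is algebraic, these already form a field.\<close>
  moreover have "R.simple_extension K x = generate_field ring_of_type_algebra (K \<union> {x})"
  proof (rule R.generate_fieldI)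
    show "subfield (R.simple_extension K x) ring_of_type_algebra"
      using R.simple_extension_is_subfield[OF K x] alg by simp
    show "K \<union> {x} \<subseteq> R.simple_extension K x"
      using R.simple_extension_incl[OF _ x, of K] R.simple_extension_mem[OF subfieldE(1)[OF K] x]
      by auto
    show "R.simple_extension K x \<subseteq> L" if "subfield L ring_of_type_algebra" "K \<union> {x} \<subseteq> L" for L
      using R.simple_extension_subring_incl[OF subfieldE(1)[OF that(1)], of K x] that by simp
  qed simp
  then have "R.dimension (Polynomial.degree P) K (generate_field ring_of_type_algebra (K \<union> {x}))"
    using R.dimension_simple_extension[OF K x alg] by (simp add: deg cs_def)
  moreover have "Polynomial.degree P \<le> Polynomial.degree Q \<and> (\<forall>y. poly P y = 0 \<longrightarrow> poly Q y = 0)"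
    if "Q \<noteq> 0" "\<And>i. poly.coeff Q i \<in> K" "poly Q x = 0" for Q
  proof -
    define ds where "ds = rev (coeffs Q)"
    have ds: "ds \<in> carrier (univ_poly ring_of_type_algebra K)"
      unfolding ds_def using that(2) by (rule rev_coeffs_mem_univ_poly)
    have "R.eval ds x = 0"
      using that(3) by (simp add: eval_eq_poly ds_def)
    then have dvd: "cs pdivides\<^bsub>ring_of_type_algebra\<^esub> ds"
      using R.Irr_minimal[OF K x alg ds] by (simp add: cs_def)
    have "ds \<noteq> []"
      using that(1) by (simp add: ds_def)
    from R.pdivides_imp_degree_le[OF subfieldE(1)[OF K] irr(1) ds this dvd]
    have "Polynomial.degree P \<le> Polynomial.degree Q"
      unfolding deg by (simp add: ds_def degree_eq_length_coeffs)
    moreover obtain es where "ds = R.poly_mult cs es"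
      using dvd by (auto simp: pdivides_def factor_def univ_poly_mult)
    then have "R.eval ds y = R.eval cs y * R.eval es y" for y
      using R.eval_poly_mult[of cs es y] by simp
    then have "poly Q y = poly P y * R.eval es y" for y
      by (simp add: eval_eq_poly ds_def P_def)
    ultimately show ?thesis
      by simp
  qed
  ultimately show thesis
    using that by blast
qed

end

section \<open>Constants, transcendence of the variable, and the Frobenius\<close>

text \<open>One set of rules serves three maps: the constants in the algebraic closure,
  \<open>to_ac\<close>, and the powers of the Frobenius.\<close>

locale field_embedding =
  fixes f :: "'a::field \<Rightarrow> 'b::field"
  assumes hom_add [simp]: "f (x + y) = f x + f y"
    and hom_mult [simp]: "f (x * y) = f x * f y"
    and hom_1 [simp]: "f 1 = 1"
begin

lemma hom_0 [simp]: "f 0 = 0"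
  by (metis add_cancel_right_right add_0 hom_add)

lemma hom_eq_0_iff [simp]: "f x = 0 \<longleftrightarrow> x = 0"
  by (metis hom_0 hom_1 hom_mult mult_zero_left right_inverse zero_neq_one)

lemma hom_uminus [simp]: "f (- x) = - f x"
  using hom_add[of x "- x"] by (simp add: eq_neg_iff_add_eq_0 add.commute)

lemma hom_eq_iff [simp]: "f x = f y \<longleftrightarrow> x = y"
  using hom_eq_0_iff[of "x + - y"] by (metis hom_add hom_uminus eq_neg_iff_add_eq_0 minus_minus)

lemma hom_power [simp]: "f (x ^ n) = f x ^ n"
  by (induction n) simp_all

lemma hom_inverse [simp]: "f (inverse x) = inverse (f x)"
proof (cases "x = 0")
  case False
  then show ?thesis
    using hom_mult[of x "inverse x"] by (metis hom_1 inverse_unique right_inverse)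
qed simp

lemma hom_sum: "f (sum g A) = (\<Sum>x\<in>A. f (g x))"
  by (induction A rule: infinite_finite_induct) simp_all

lemma hom_of_nat [simp]: "f (of_nat n) = of_nat n"
  by (induction n) simp_all

lemma subfield_range: "subfield (range f) ring_of_type_algebra"
proof (rule subfieldI_type)
  show "0 \<in> range f" "1 \<in> range f"
    by (metis hom_0 rangeI, metis hom_1 rangeI)
  fix x y assume "x \<in> range f" "y \<in> range f"
  then obtain u v where "x = f u" "y = f v"
    by blast
  then show "- x \<in> range f" "x + y \<in> range f" "x * y \<in> range f" "inverse x \<in> range f"
    by (metis hom_uminus rangeI, metis hom_add rangeI, metis hom_mult rangeI,
        metis hom_inverse rangeI)
qed

lemma coeff_map [simp]: "poly.coeff (map_poly f P) n = f (poly.coeff P n)"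
  by (simp add: coeff_map_poly)

lemma map_poly_hom_add [simp]: "map_poly f (P + Q) = map_poly f P + map_poly f Q"
  by (rule poly_eqI) simp

lemma map_poly_hom_uminus [simp]: "map_poly f (- P) = - map_poly f P"
  by (rule poly_eqI) simp

lemma map_poly_hom_mult [simp]: "map_poly f (P * Q) = map_poly f P * map_poly f Q"
  by (rule poly_eqI) (simp add: coeff_mult hom_sum)

lemma map_poly_hom_power [simp]: "map_poly f (P ^ n) = map_poly f P ^ n"
  by (induction n) simp_all

lemma map_poly_hom_prod: "map_poly f (prod g A) = (\<Prod>x\<in>A. map_poly f (g x))"
  by (induction A rule: infinite_finite_induct) simp_all

lemma map_poly_hom_eq_iff [simp]: "map_poly f P = map_poly f Q \<longleftrightarrow> P = Q"
  by (simp add: poly_eq_iff)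

lemma map_poly_hom_eq_0_iff [simp]: "map_poly f P = 0 \<longleftrightarrow> P = 0"
  using map_poly_hom_eq_iff[of P 0] by simp

lemma degree_map_poly_hom [simp]: "Polynomial.degree (map_poly f P) = Polynomial.degree P"
  by (rule degree_map_poly) simp

lemma poly_map_poly_hom: "poly (map_poly f P) (f x) = f (poly P x)"
  by (induction P) (simp_all add: map_poly_pCons)

end

text \<open>For nonzero \<open>x\<close> this is Lagrange's theorem in the multiplicative
  group.\<close>

lemma finite_field_power_card:
  fixes x :: "'q::{finite,field}"
  shows "x ^ card (UNIV :: 'q set) = x"
proof (cases "x = 0")
  case False
  interpret R: field "ring_of_type_algebra :: 'q ring"
    by (rule field_from_type_algebra)
  have "Coset.order (Multiplicative_Group.mult_of (ring_of_type_algebra :: 'q ring)) = card (UNIV :: 'q set) - 1"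
    by (simp add: Coset.order_def)
  moreover have "x [^]\<^bsub>Multiplicative_Group.mult_of ring_of_type_algebra\<^esub> Coset.order (Multiplicative_Group.mult_of (ring_of_type_algebra :: 'q ring)) = 1"
    using group.pow_order_eq_1[OF R.field_mult_group, of x] False by simp
  ultimately have "x ^ (card (UNIV :: 'q set) - 1) = 1"
    by (simp add: Multiplicative_Group.nat_pow_mult_of)
  then show ?thesis
    by (metis One_nat_def Suc_pred finite_UNIV_card_ge_0 finite mult.right_neutral power_Suc)
qed (simp add: power_0_left)

section \<open>Constants and the variable inside the algebraic closure\<close>

definition const_ac :: "'q::field \<Rightarrow> 'q poly fract alg_closure"
  where "const_ac c = to_ac (const_fract c)"

interpretation const_ac: field_embedding const_ac
  by unfold_locales (simp_all add: const_ac_def const_fract_def flip: to_fract_add to_fract_mult to_ac_mult to_ac_add one_pCons)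

abbreviation poly_ac :: "'q::field poly \<Rightarrow> 'q poly fract alg_closure poly"
  where "poly_ac \<equiv> map_poly const_ac"

definition T_ac :: "'q::field poly fract alg_closure"
  where "T_ac = to_ac (to_fract [:0, 1:])"

text \<open>Since the right-hand side vanishes only for \<open>f = 0\<close>, this expresses the
  transcendence of T over the finite field.\<close>

lemma poly_poly_ac: "poly (poly_ac f) T_ac = to_ac (to_fract f)"
proof (induction f)
  case (pCons c f)
  have "to_fract (pCons c f) = to_fract [:c:] + to_fract [:0, 1:] * to_fract f"
    by (simp flip: to_fract_add to_fract_mult)
  then show ?case
    using pCons by (simp add: map_poly_pCons T_ac_def const_ac_def const_fract_def)
qed simp

lemma Fq_altdef: "Fq = range const_ac"
  by (simp add: Fq_def const_ac_def)

lemma subfield_Fq: "subfield Fq (Kbar :: 'q::field poly fract alg_closure ring)"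
  unfolding Fq_altdef by (rule const_ac.subfield_range)

interpretation to_ac: field_embedding to_ac
  by unfold_locales simp_all

lemma subfield_Kq: "subfield Kq (Kbar :: 'q::field poly fract alg_closure ring)"
  unfolding Kq_def by (rule to_ac.subfield_range)

text \<open>\<open>x\<close> is a root of X^n - x^n; positivity of \<open>n\<close> keeps this
  polynomial from being zero.\<close>

lemma algebraic_Fq_if_power_mem:
  assumes "x ^ n \<in> Fq" "n > 0"
  shows "ring.algebraic Kbar Fq x"
  unfolding algebraic_iff_poly[OF subfield_Fq]
proof (intro exI conjI allI)
  let ?P = "Polynomial.monom 1 n - [:x ^ n:]"
  show "poly ?P x = 0"
    by (simp add: poly_monom)
  show "poly.coeff ?P i \<in> Fq" for i
    using assms subfield_closed[OF subfield_Fq] by (auto simp: coeff_pCons split: nat.split)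
  have "poly.coeff ?P n = 1"
    using assms by (simp add: coeff_pCons split: nat.split)
  then show "?P \<noteq> 0"
    by (metis coeff_0 zero_neq_one)
qed

section \<open>The Frobenius, its fixed points and its periodic points\<close>

locale finite_constant_field =
  fixes p k :: nat and q_type :: "'q::{finite,field} itself"
  assumes prime_p: "prime p" and card_q: "card (UNIV :: 'q set) = p ^ k"
begin

text \<open>Translation by 1 permutes the field, so adding 1 to every element leaves the sum of all
  elements unchanged. Hence the cardinality is zero in the field, and the characteristic is a prime
  dividing a power of \<open>p\<close>.\<close>

lemma CHAR_q: "CHAR('q) = p"
proof -
  have "(\<Sum>x\<in>UNIV. x :: 'q) = (\<Sum>x\<in>UNIV. x + 1)"
    by (rule sum.reindex_bij_witness[of _ "\<lambda>x. x + 1" "\<lambda>x. x - 1"]) simp_all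
  then have "of_nat (card (UNIV :: 'q set)) = (0 :: 'q)"
    by (simp add: sum.distrib)
  then have "CHAR('q) dvd p ^ k"
    by (simp only: of_nat_eq_0_iff_char_dvd card_q)
  moreover have "prime CHAR('q)"
    by (intro prime_CHAR_semidom finite_imp_CHAR_pos) simp
  ultimately show ?thesis
    using prime_p by (metis prime_dvd_power primes_dvd_imp_eq)
qed

lemma CHAR_Kbar: "CHAR('q poly fract alg_closure) = p"
proof (rule CHAR_eqI)
  have "const_ac (of_nat n :: 'q) = of_nat n" for n
    by (rule const_ac.hom_of_nat)
  then have eq: "(of_nat n = (0 :: 'q poly fract alg_closure)) \<longleftrightarrow> (of_nat n = (0 :: 'q))" for n
    using const_ac.hom_eq_0_iff[of "of_nat n"] by simp
  show "of_nat p = (0 :: 'q poly fract alg_closure)"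
    unfolding eq using CHAR_q of_nat_CHAR by metis
  show "p dvd n" if "of_nat n = (0 :: 'q poly fract alg_closure)" for n
    using that unfolding eq by (simp add: of_nat_eq_0_iff_char_dvd CHAR_q)
qed

text \<open>With q = \<open>p ^ k\<close> this is x -> x^(q^s), the \<open>s\<close>-fold iterate of
  the q-Frobenius.\<close>

definition frob :: "nat \<Rightarrow> 'q poly fract alg_closure \<Rightarrow> 'q poly fract alg_closure"
  where "frob s x = x ^ (p ^ (k * s))"

sublocale frob: field_embedding "frob s" for s
proof
  show "frob s (x + y) = frob s x + frob s y" for x y
    unfolding frob_def by (rule freshmans_dream'[where n = "k * s"]) (unfold CHAR_Kbar, simp_all add: prime_p)
qed (simp_all add: frob_def power_mult_distrib)

lemma frob_frob: "frob s (frob t x) = frob (s + t) x"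
  by (simp add: frob_def add.commute flip: power_mult power_add distrib_left)

lemma frob_0 [simp]: "frob 0 = id"
  by (simp add: frob_def fun_eq_iff)

lemma frob_fixed_mult: "frob s x = x \<Longrightarrow> frob (s * n) x = x"
  by (induction n) (simp_all flip: frob_frob)

lemma frob_const_ac [simp]: "frob s (const_ac c) = const_ac c"
proof -
  have "frob 1 (const_ac c) = const_ac (c ^ card (UNIV :: 'q set))"
    by (simp add: frob_def card_q)
  then have "frob 1 (const_ac c) = const_ac c"
    by (simp only: finite_field_power_card)
  from frob_fixed_mult[OF this, of s] show ?thesis
    by simp
qed

text \<open>The fixed points are the roots of X^N - X with N = \<open>p ^ k\<close>. There are at
  most N of them, and the N constants are among them.\<close>

lemma range_const_ac: "range const_ac = {x. frob 1 x = x}"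
proof -
  define N where "N = p ^ k"
  let ?P = "Polynomial.monom 1 N - [:0, 1:] :: 'q poly fract alg_closure poly"
  have N: "card (UNIV :: 'q set) = N"
    by (simp add: N_def card_q)
  \<comment> \<open>A field has at least two elements, so \<open>N > 1\<close> and the terms X^N and
    X do not cancel.\<close>
  have "card {0, 1 :: 'q} \<le> card (UNIV :: 'q set)"
    by (rule card_mono) simp_all
  then have "N > 1"
    by (simp add: N)
  then have "poly.coeff ?P N = 1"
    by (simp add: coeff_pCons split: nat.split)
  then have "?P \<noteq> 0"
    by (metis coeff_0 zero_neq_one)
  have eq: "{x. frob 1 x = x} = {x. poly ?P x = 0}"
    by (simp add: frob_def poly_monom N_def)
  have deg: "Polynomial.degree ?P \<le> N"
    using \<open>N > 1\<close> by (intro degree_diff_le) (simp_all add: degree_monom_le)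
  have "range const_ac \<subseteq> {x. frob 1 x = x}"
    by auto
  moreover have "finite {x. frob 1 x = x}"
    unfolding eq using \<open>?P \<noteq> 0\<close> by (rule poly_roots_finite)
  moreover have "card {x. frob 1 x = x} \<le> N"
    using card_poly_roots_bound[OF \<open>?P \<noteq> 0\<close>] deg unfolding eq by simp
  moreover have "card (range (const_ac :: 'q \<Rightarrow> _)) = N"
    by (subst card_image) (simp_all add: N inj_on_def)
  ultimately show ?thesis
    by (metis card_seteq)
qed

lemma map_poly_frob_frob: "map_poly (frob s) (map_poly (frob t) P) = map_poly (frob (s + t)) P"
  by (rule poly_eqI) (simp add: frob_frob)

lemma map_poly_frob_mult:
  "map_poly (frob s) P = P \<Longrightarrow> map_poly (frob (s * n)) P = P"
  by (simp add: poly_eq_iff frob_fixed_mult)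

lemma map_poly_frob_poly_ac [simp]: "map_poly (frob s) (poly_ac f) = poly_ac f"
  by (simp add: poly_eq_iff)

text \<open>This brings Frobenius-invariant polynomials over the closure back to polynomials over
  the finite field.\<close>

lemma range_poly_ac: "range poly_ac = {P. map_poly (frob 1) P = P}"
proof -
  have "P \<in> range poly_ac" if "map_poly (frob 1) P = P" for P
  proof (rule range_eqI)
    have "poly.coeff (map_poly (frob 1) P) i = poly.coeff P i" for i
      by (simp only: that)
    then have mem: "poly.coeff P i \<in> range const_ac" for i
      unfolding range_const_ac frob.coeff_map by simp
    have inj: "inj (const_ac :: 'q \<Rightarrow> _)"
      by (simp add: inj_on_def)
    show "P = poly_ac (map_poly (the_inv const_ac) P)"
    proof (rule poly_eqI)
      fix i
      \<comment> \<open>\<open>map_poly\<close> commutes with taking coefficients beyond the degree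
        only for a map that preserves 0.\<close>
      have "the_inv const_ac 0 = (0 :: 'q)"
        using the_inv_f_f[OF inj, of 0] by simp
      then show "poly.coeff P i = poly.coeff (poly_ac (map_poly (the_inv const_ac) P)) i"
        by (simp add: coeff_map_poly f_the_inv_into_f[OF inj mem])
    qed
  qed
  then show ?thesis
    using map_poly_frob_poly_ac by blast
qed

text \<open>The Frobenius permutes the finitely many roots of a polynomial over the finite field, so
  the orbit of \<open>x\<close> repeats; injectivity of \<open>frob i\<close> turns the repetition
  into a return to \<open>x\<close>.\<close>

lemma frob_periodic_if_algebraic:
  assumes "ring.algebraic Kbar Fq x"
  obtains s where "s > 0" "frob s x = x"
proof -
  obtain P where P: "P \<noteq> 0" "\<And>i. poly.coeff P i \<in> Fq" "poly P x = 0"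
    using assms unfolding algebraic_iff_poly[OF subfield_Fq] by blast
  have "map_poly (frob 1) P = P"
    using P(2) unfolding Fq_altdef range_const_ac by (simp add: poly_eq_iff)
  then have "map_poly (frob s) P = P" for s
    using map_poly_frob_mult[of 1 P s] by simp
  then have "poly P (frob s x) = 0" for s
    using frob.poly_map_poly_hom[of s P x] P(3) by simp
  then have "(\<lambda>s. frob s x) ` UNIV \<subseteq> {y. poly P y = 0}"
    by auto
  then have "finite (range (\<lambda>s. frob s x))"
    using poly_roots_finite[OF P(1)] by (rule finite_subset)
  then have "\<not> inj (\<lambda>s. frob s x)"
    using finite_imageD infinite_UNIV_nat by blast
  then obtain i j where ij: "frob i x = frob j x" "i < j"
    by (metis injI linorder_neqE_nat)
  then have "frob i x = frob i (frob (j - i) x)"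
    by (simp add: frob_frob)
  then show thesis
    using that[of "j - i"] ij(2) by simp
qed

end

section \<open>Roots of rational functions with algebraic constants\<close>

text \<open>With e * u = h * v + gcd e h, the witness is c'^u / c^v: formally it is x to the
  exponent u/h - v/e = 1 / lcm e h. This will show that every admissible exponent divides the
  largest one.\<close>

lemma power_lcm_if_powers:
  fixes x c c' :: "'a::field"
  assumes "x \<noteq> 0" "x = c ^ e" "x = c' ^ h" "e > 0" "h > 0"
  obtains w where "x = w ^ lcm e h"
proof -
  define g where "g = gcd e h"
  obtain e' h' where eh: "e = e' * g" "h = h' * g"
    unfolding g_def using gcd_coprime_exists[of e h] assms by auto
  have g: "g > 0"
    using assms by (simp add: g_def)
  obtain u v where uv: "e * u = h * v + g"
    unfolding g_def using bezout_nat[of e h] assms by auto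
  have "(e' * u) * g = (h' * v + 1) * g"
    using uv unfolding eh by (simp add: algebra_simps)
  then have uv': "e' * u = h' * v + 1"
    using g by (metis less_not_refl mult_cancel2)
  have "lcm e h * g = (e * h') * g" "lcm e h * g = (h * e') * g"
    using prod_gcd_lcm_nat[of e h] unfolding g_def[symmetric]
    by (metis eh(2) mult.assoc mult.commute, metis eh(1) mult.assoc mult.commute)
  then have lcm: "lcm e h = e * h'" "lcm e h = h * e'"
    using g by (metis less_not_refl mult_cancel2)+
  have "(c' ^ u / c ^ v) ^ lcm e h = c' ^ (u * lcm e h) / c ^ (v * lcm e h)"
    by (simp add: power_divide power_mult)
  also have "c' ^ (u * lcm e h) = x ^ (e' * u)"
    unfolding lcm(2) assms(3) by (simp add: mult_ac flip: power_mult)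
  also have "c ^ (v * lcm e h) = x ^ (h' * v)"
    unfolding lcm(1) assms(2) by (simp add: mult_ac flip: power_mult)
  also have "x ^ (e' * u) / x ^ (h' * v) = x"
    using assms(1) by (simp add: uv')
  finally show thesis
    using that by metis
qed

lemma to_fract_power: "to_fract (x ^ n) = to_fract x ^ n"
  by (induction n) simp_all

section \<open>Monic polynomials and coprime quotients\<close>

lemma monic_part_eq_self:
  "Polynomial.lead_coeff P = 1 \<Longrightarrow> monic_part P = (P :: 'a::field poly)"
  by (simp add: monic_part_def)

lemma monic_part_power: "monic_part (P ^ n) = monic_part P ^ n"
  by (induction n) (simp_all add: monic_part_mult monic_part_eq_self)

lemma monic_part_eq_0_iff [simp]: "monic_part P = 0 \<longleftrightarrow> P = 0"
  by (auto simp: monic_part_def)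

lemma degree_monic_part [simp]: "Polynomial.degree (monic_part P) = Polynomial.degree P"
  by (cases "P = 0") (simp_all add: monic_part_def)

lemma monic_part_dvd_iff [simp]: "monic_part P dvd Q \<longleftrightarrow> P dvd Q"
  by (cases "P = 0") (simp_all add: monic_part_def smult_dvd_iff)

lemma dvd_monic_part_iff [simp]: "Q dvd monic_part P \<longleftrightarrow> Q dvd P"
  by (cases "P = 0") (simp_all add: monic_part_def dvd_smult_iff)

lemma coprime_monic_part:
  "coprime P Q \<Longrightarrow> coprime (monic_part P) (monic_part Q)"
  by (simp add: coprime_def)

lemma (in field_embedding) monic_part_map_poly:
  "monic_part (map_poly f P) = map_poly f (monic_part P)"
  by (rule poly_eqI) (simp add: monic_part_def)

text \<open>The cofactor has degree 0 and leading coefficient 1.\<close>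

lemma monic_eq_if_dvd:
  fixes P Q :: "'a::field poly"
  assumes "P dvd Q" "Polynomial.lead_coeff P = 1" "Polynomial.lead_coeff Q = 1"
    "Polynomial.degree Q = Polynomial.degree P"
  shows "P = Q"
proof -
  obtain W where W: "Q = P * W"
    using assms(1) by blast
  moreover have "P \<noteq> 0" "W \<noteq> 0"
    using W assms(2,3) by auto
  ultimately have "Polynomial.degree W = 0"
    using assms(4) by (simp add: degree_mult_eq)
  moreover have "Polynomial.lead_coeff W = 1"
    using assms(2,3) unfolding W lead_coeff_mult by simp
  ultimately have "W = 1"
    by (metis degree_0_id lead_coeff_1 one_pCons coeff_pCons_0 degree_eq_zeroE)
  then show ?thesis
    using W by simp
qed

text \<open>Divisibility of \<open>e\<close>-th powers passes to their bases; being monic excludes a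
  constant factor that is an \<open>e\<close>-th root of unity.\<close>

lemma monic_power_eqD:
  fixes P Q :: "'a::field alg_closure poly"
  assumes "P ^ e = Q ^ e" "e > 0" "Polynomial.lead_coeff P = 1" "Polynomial.lead_coeff Q = 1"
  shows "P = Q"
proof (rule monic_eq_if_dvd)
  show "P dvd Q"
    using assms(1,2) by (metis dvd_refl pow_divides_pow_iff)
  have "P \<noteq> 0" "Q \<noteq> 0"
    using assms by auto
  then show "Polynomial.degree Q = Polynomial.degree P"
    using arg_cong[OF assms(1), of Polynomial.degree] assms(2) by (simp add: degree_power_eq)
qed (use assms in simp_all)

text \<open>The identity is f / g = (P / Q)^e without denominators; replacing \<open>P\<close> and
  \<open>Q\<close> by their quotients by the gcd cancels its \<open>e\<close>-th power on both
  sides.\<close>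

lemma obtain_coprime_quotient:
  fixes P Q :: "'a::field alg_closure poly"
  assumes "f * Q ^ e = g * P ^ e" "P \<noteq> 0" "Q \<noteq> 0"
  obtains P' Q' where "coprime P' Q'" "P' \<noteq> 0" "Q' \<noteq> 0" "f * Q' ^ e = g * P' ^ e"
proof -
  define D where "D = gcd P Q"
  have "D \<noteq> 0"
    using assms(2) by (simp add: D_def)
  obtain P' Q' where PQ: "P = P' * D" "Q = Q' * D" "coprime P' Q'"
    unfolding D_def using gcd_coprime_exists[of P Q] assms(2) by auto
  have "(f * Q' ^ e) * D ^ e = (g * P' ^ e) * D ^ e"
    using assms(1) by (simp add: PQ power_mult_distrib mult_ac)
  then have "f * Q' ^ e = g * P' ^ e"
    using \<open>D \<noteq> 0\<close> by simp
  then show thesis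
    using that[of P' Q'] PQ assms by auto
qed

section \<open>Polynomials and fractions with algebraic constants\<close>

context finite_constant_field
begin

text \<open>These are the polynomials with coefficients algebraic over the finite field: finitely
  many such coefficients have a common Frobenius period.\<close>

definition periodic_polys :: "'q poly fract alg_closure poly set"
  where "periodic_polys = {P. \<exists>s>0. map_poly (frob s) P = P}"

lemma periodic_polysE2:
  assumes "P \<in> periodic_polys" "Q \<in> periodic_polys"
  obtains s where "s > 0" "map_poly (frob s) P = P" "map_poly (frob s) Q = Q"
proof -
  obtain s t where "s > 0" "map_poly (frob s) P = P" "t > 0" "map_poly (frob t) Q = Q"
    using assms unfolding periodic_polys_def by blast
  then show thesis
    using that[of "s * t"] map_poly_frob_mult[of s P t] map_poly_frob_mult[of t Q s]
    by (simp add: mult.commute)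
qed

lemma periodic_polys_add:
  assumes "P \<in> periodic_polys" "Q \<in> periodic_polys"
  shows "P + Q \<in> periodic_polys"
proof -
  obtain s where "s > 0" "map_poly (frob s) P = P" "map_poly (frob s) Q = Q"
    using assms by (rule periodic_polysE2)
  then show ?thesis
    by (auto simp: periodic_polys_def)
qed

lemma periodic_polys_mult:
  assumes "P \<in> periodic_polys" "Q \<in> periodic_polys"
  shows "P * Q \<in> periodic_polys"
proof -
  obtain s where "s > 0" "map_poly (frob s) P = P" "map_poly (frob s) Q = Q"
    using assms by (rule periodic_polysE2)
  then show ?thesis
    by (auto simp: periodic_polys_def)
qed

lemma periodic_polys_uminus: "P \<in> periodic_polys \<Longrightarrow> - P \<in> periodic_polys"
  by (auto simp: periodic_polys_def)

lemma periodic_polys_poly_ac: "poly_ac f \<in> periodic_polys"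
  by (auto simp: periodic_polys_def)

lemma periodic_polys_power: "P \<in> periodic_polys \<Longrightarrow> P ^ n \<in> periodic_polys"
proof (induction n)
  case 0
  then show ?case
    using periodic_polys_poly_ac[of 1] by simp
qed (simp add: periodic_polys_mult)

text \<open>
  The product of the conjugates of \<open>P\<close> under the Frobenius is fixed by the Frobenius, so that
  the transcendence of \<open>T\<close> over the finite field applies to it.
\<close>

lemma periodic_poly_eq_0:
  assumes "P \<in> periodic_polys" "poly P T_ac = 0"
  shows "P = 0"
proof -
  obtain s where s: "s > 0" "map_poly (frob s) P = P"
    using assms(1) by (auto simp: periodic_polys_def)
  define N where "N = (\<Prod>j<s. map_poly (frob j) P)"
  have "map_poly (frob 1) N = (\<Prod>j<s. map_poly (frob (Suc j)) P)"
    by (simp add: N_def frob.map_poly_hom_prod map_poly_frob_frob)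
  \<comment> \<open>The Frobenius shifts the factors cyclically: the factor with index
    \<open>s\<close> is \<open>P\<close> again and replaces the one with index 0.\<close>
  also have "\<dots> = N"
  proof -
    obtain m where m: "s = Suc m"
      using s(1) gr0_implies_Suc by blast
    have "(\<Prod>j<s. map_poly (frob (Suc j)) P) = (\<Prod>j<m. map_poly (frob (Suc j)) P) * P"
      using s(2) unfolding m by simp
    also have "\<dots> = N"
      unfolding N_def m prod.lessThan_Suc_shift by (simp add: mult.commute)
    finally show ?thesis .
  qed
  finally obtain f where f: "N = poly_ac f"
    using range_poly_ac by auto
  have "poly N T_ac = (\<Prod>j<s. poly (map_poly (frob j) P) T_ac)"
    by (simp add: N_def poly_prod)
  also have "\<dots> = 0"
    using s(1) assms(2) by (intro prod_zero) (auto intro!: bexI[of _ 0])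
  finally have "f = 0"
    by (simp add: f poly_poly_ac)
  then have "N = 0"
    by (simp add: f)
  then show ?thesis
    by (simp add: N_def)
qed

text \<open>This is the field of rational functions in T over the algebraic closure of the finite
  field. By \<open>periodic_poly_eq_0\<close>, a nonzero \<open>Q\<close> gives a nonzero
  denominator.\<close>

definition periodic_fracts :: "'q poly fract alg_closure set"
  where "periodic_fracts = {poly P T_ac / poly Q T_ac |P Q.
    P \<in> periodic_polys \<and> Q \<in> periodic_polys \<and> Q \<noteq> 0}"

lemma periodic_fractsI:
  "P \<in> periodic_polys \<Longrightarrow> Q \<in> periodic_polys \<Longrightarrow> Q \<noteq> 0 \<Longrightarrow> x = poly P T_ac / poly Q T_ac \<Longrightarrow>
    x \<in> periodic_fracts"
  by (auto simp: periodic_fracts_def)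

lemma Kq_subset_periodic_fracts: "Kq \<subseteq> periodic_fracts"
proof
  fix x :: "'q poly fract alg_closure" assume "x \<in> Kq"
  then obtain a where "x = to_ac a"
    by (auto simp: Kq_def)
  moreover obtain f g where "a = Fract f g" "g \<noteq> 0"
    by (cases a)
  ultimately show "x \<in> periodic_fracts"
    by (intro periodic_fractsI[of "poly_ac f" "poly_ac g"])
      (simp_all add: periodic_polys_poly_ac poly_poly_ac Fract_conv_to_fract)
qed

lemma algebraic_in_periodic_fracts:
  assumes "ring.algebraic Kbar Fq x"
  shows "x \<in> periodic_fracts"
proof -
  obtain s where "s > 0" "frob s x = x"
    using assms by (rule frob_periodic_if_algebraic)
  then have "[:x:] \<in> periodic_polys"
    by (auto simp: periodic_polys_def map_poly_pCons)
  then show ?thesis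
    using periodic_polys_poly_ac[of 1] by (intro periodic_fractsI[of "[:x:]" 1]) simp_all
qed

lemma subfield_periodic_fracts: "subfield periodic_fracts Kbar"
proof (rule subfieldI_type)
  have "Kq \<subseteq> periodic_fracts"
    by (rule Kq_subset_periodic_fracts)
  then show "0 \<in> periodic_fracts" "1 \<in> periodic_fracts"
    using subfield_closed(1,2)[OF subfield_Kq] by blast+
next
  fix x y assume "x \<in> periodic_fracts" "y \<in> periodic_fracts"
  then obtain P Q R S where x: "x = poly P T_ac / poly Q T_ac" and y: "y = poly R T_ac / poly S T_ac"
    and mem: "P \<in> periodic_polys" "Q \<in> periodic_polys" "R \<in> periodic_polys" "S \<in> periodic_polys"
    and nz: "Q \<noteq> 0" "S \<noteq> 0"
    by (auto simp: periodic_fracts_def)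
  have nz': "poly Q T_ac \<noteq> 0" "poly S T_ac \<noteq> 0"
    using periodic_poly_eq_0 mem nz by blast+
  show "- x \<in> periodic_fracts"
    using mem nz by (intro periodic_fractsI[of "- P" Q]) (simp_all add: x periodic_polys_uminus)
  show "x + y \<in> periodic_fracts"
    unfolding x y add_frac_eq[OF nz']
    using mem nz
    by (intro periodic_fractsI[of "P * S + R * Q" "Q * S"])
      (simp_all add: periodic_polys_add periodic_polys_mult)
  show "x * y \<in> periodic_fracts"
    using mem nz
    by (intro periodic_fractsI[of "P * R" "Q * S"]) (simp_all add: x y periodic_polys_mult)
  show "inverse x \<in> periodic_fracts"
  proof (cases "P = 0")
    case True
    then show ?thesis
      using \<open>x \<in> periodic_fracts\<close> by (simp add: x)
  next
    case False
    then show ?thesis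
      using mem nz by (intro periodic_fractsI[of Q P]) (simp_all add: x)
  qed
qed

text \<open>
  The coprime monic pair \<open>P, Q\<close> with \<open>f / g = (P / Q) ^ e\<close> is unique, hence fixed by the
  Frobenius.
\<close>

lemma monic_fraction_root_descends:
  fixes f g :: "'q poly"
  assumes eq: "poly_ac f * Q ^ e = poly_ac g * P ^ e"
    and nz: "f \<noteq> 0" "g \<noteq> 0" "P \<noteq> 0" "Q \<noteq> 0" and "e > 0"
  obtains r s where "r \<noteq> 0" "s \<noteq> 0" "monic_part f * s ^ e = monic_part g * r ^ e"
proof -
  obtain P' Q' where PQ': "coprime P' Q'" "P' \<noteq> 0" "Q' \<noteq> 0" "poly_ac f * Q' ^ e = poly_ac g * P' ^ e"
    using obtain_coprime_quotient[OF eq nz(3,4)] .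
  define P1 where "P1 = monic_part P'"
  define Q1 where "Q1 = monic_part Q'"
  define f1 where "f1 = poly_ac (monic_part f)"
  define g1 where "g1 = poly_ac (monic_part g)"
  let ?\<sigma> = "map_poly (frob 1)"
  have monic: "Polynomial.lead_coeff P1 = 1" "Polynomial.lead_coeff Q1 = 1"
    unfolding P1_def Q1_def using PQ' monic_part_characterization(1) by blast+
  have eq1: "f1 * Q1 ^ e = g1 * P1 ^ e"
    using arg_cong[OF PQ'(4), of monic_part]
    by (simp add: monic_part_mult monic_part_power const_ac.monic_part_map_poly f1_def g1_def
        P1_def Q1_def)
  have eq2: "f1 * ?\<sigma> Q1 ^ e = g1 * ?\<sigma> P1 ^ e"
    using arg_cong[OF eq1, of ?\<sigma>]
    unfolding frob.map_poly_hom_mult frob.map_poly_hom_power by (simp add: f1_def g1_def)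
  \<comment> \<open>The fraction \<open>P1 / Q1\<close> and its Frobenius image have the same
    \<open>e\<close>-th power; cross-multiplication turns this into equal powers of two monic
    polynomials.\<close>
  have "(f1 * g1) * (Q1 * ?\<sigma> P1) ^ e = (f1 * Q1 ^ e) * (g1 * ?\<sigma> P1 ^ e)"
    by (simp add: power_mult_distrib)
  also have "\<dots> = (f1 * g1) * (P1 * ?\<sigma> Q1) ^ e"
    unfolding eq1 eq2[symmetric] by (simp add: power_mult_distrib)
  finally have "(Q1 * ?\<sigma> P1) ^ e = (P1 * ?\<sigma> Q1) ^ e"
    using nz by (simp add: f1_def g1_def)
  then have cross: "Q1 * ?\<sigma> P1 = P1 * ?\<sigma> Q1"
    by (rule monic_power_eqD[OF _ \<open>e > 0\<close>]) (simp_all add: lead_coeff_mult monic)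
  have "coprime P1 Q1"
    unfolding P1_def Q1_def using PQ'(1) by (rule coprime_monic_part)
  \<comment> \<open>By coprimality each of \<open>P1\<close> and \<open>Q1\<close> divides its own
    image, which is monic of the same degree.\<close>
  have "P1 dvd Q1 * ?\<sigma> P1" "Q1 dvd P1 * ?\<sigma> Q1"
    using cross by (metis dvd_triv_left)+
  then have "P1 dvd ?\<sigma> P1" "Q1 dvd ?\<sigma> Q1"
    using \<open>coprime P1 Q1\<close> by (simp_all add: coprime_dvd_mult_right_iff coprime_commute)
  then have "P1 = ?\<sigma> P1" "Q1 = ?\<sigma> Q1"
    using monic by (auto intro!: monic_eq_if_dvd)
  then have "P1 \<in> range poly_ac" "Q1 \<in> range poly_ac"
    unfolding range_poly_ac by auto
  then obtain r s where rs: "P1 = poly_ac r" "Q1 = poly_ac s"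
    by blast
  have "poly_ac (monic_part f * s ^ e) = poly_ac (monic_part g * r ^ e)"
    using eq1 by (simp add: f1_def g1_def rs)
  then have "monic_part f * s ^ e = monic_part g * r ^ e"
    by (simp only: const_ac.map_poly_hom_eq_iff)
  moreover have "r \<noteq> 0" "s \<noteq> 0"
    using monic rs by auto
  ultimately show thesis
    using that by blast
qed

text \<open>Clearing denominators gives a polynomial with periodic coefficients that vanishes at
  \<open>T_ac\<close>. It is therefore zero, and the resulting polynomial identity is one from which
  the root descends.\<close>

lemma monic_fract_is_power:
  assumes "a \<noteq> 0" "to_ac a = y ^ e" "e > 0" "y \<in> periodic_fracts"
  obtains c where "c \<noteq> 0" "monic_fract a = c ^ e"
proof -
  obtain f g where a: "a = Fract f g" "g \<noteq> 0"
    by (cases a)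
  have "f \<noteq> 0"
    using assms(1) a by (auto simp: fract_collapse)
  obtain P Q where y: "y = poly P T_ac / poly Q T_ac"
    and mem: "P \<in> periodic_polys" "Q \<in> periodic_polys" and "Q \<noteq> 0"
    using assms(4) by (auto simp: periodic_fracts_def)
  have nz: "poly Q T_ac \<noteq> 0"
    using periodic_poly_eq_0 mem \<open>Q \<noteq> 0\<close> by blast
  have "P \<noteq> 0"
    using assms(1-3) y by (auto simp: power_0_left)
  let ?R = "poly_ac f * Q ^ e + - (poly_ac g * P ^ e)"
  have "to_ac (to_fract f) / to_ac (to_fract g) = (poly P T_ac / poly Q T_ac) ^ e"
    using assms(2) by (simp add: a y Fract_conv_to_fract)
  then have "poly ?R T_ac = 0"
    using a(2) nz by (simp add: poly_poly_ac field_simps)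
  moreover have "?R \<in> periodic_polys"
    by (intro periodic_polys_add periodic_polys_uminus periodic_polys_mult periodic_polys_power
        periodic_polys_poly_ac mem)
  ultimately have "?R = 0"
    using periodic_poly_eq_0 by blast
  then have "poly_ac f * Q ^ e = poly_ac g * P ^ e"
    by simp
  then obtain r s where rs: "r \<noteq> 0" "s \<noteq> 0" "monic_part f * s ^ e = monic_part g * r ^ e"
    using \<open>f \<noteq> 0\<close> a(2) \<open>P \<noteq> 0\<close> \<open>Q \<noteq> 0\<close> assms(3) by (rule monic_fraction_root_descends)
  have "to_fract (monic_part f) * to_fract s ^ e = to_fract (monic_part g) * to_fract r ^ e"
    using arg_cong[OF rs(3), of to_fract] by (simp add: to_fract_power)
  then have "monic_fract a = (to_fract r / to_fract s) ^ e"
    using \<open>f \<noteq> 0\<close> a(2) rs(2)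
    unfolding a(1) monic_fract_Fract[OF \<open>f \<noteq> 0\<close> a(2)]
    by (simp add: Fract_conv_to_fract field_simps)
  then show thesis
    using that[of "to_fract r / to_fract s"] rs by simp
qed

end

section \<open>The power index and Kummer theory\<close>

lemma monic_fract_eq_const_mult:
  fixes a :: "'q::field poly fract"
  assumes "a \<noteq> 0"
  obtains u where "u \<noteq> 0" "a = const_fract u * monic_fract a"
proof -
  obtain f g where fg: "a = Fract f g" "g \<noteq> 0"
    by (cases a)
  have "f \<noteq> 0"
    using assms fg by (auto simp: fract_collapse)
  define u where "u = Polynomial.lead_coeff f / Polynomial.lead_coeff g"
  have "const_fract u * monic_fract a = Fract ([:u:] * monic_part f) (monic_part g)"
    by (simp add: fg(1) monic_fract_Fract[OF \<open>f \<noteq> 0\<close> fg(2)] const_fract_def to_fract_def)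
  also have "\<dots> = a"
    using \<open>f \<noteq> 0\<close> fg(2) by (simp add: fg(1) eq_fract u_def monic_part_def inverse_eq_divide)
  finally show thesis
    using that[of u] \<open>f \<noteq> 0\<close> fg(2) by (simp add: u_def)
qed

text \<open>For \<open>c\<close> in lowest terms R / S, R^t divides the numerator and S^t the
  denominator of \<open>monic_fract a\<close>. If \<open>t\<close> exceeds the sum of their degrees,
  R and S are constant, and then so is \<open>a\<close>.\<close>

lemma power_exponent_le:
  fixes a :: "'q::field poly fract"
  assumes a: "a \<notin> range const_fract"
  obtains B where "\<And>t c. c \<noteq> 0 \<Longrightarrow> monic_fract a = c ^ t \<Longrightarrow> t \<le> B"
proof -
  obtain f g where fg: "a = Fract f g" "g \<noteq> 0"
    by (cases a)
  have "f \<noteq> 0"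
  proof
    assume "f = 0"
    then have "a = const_fract 0"
      by (simp add: fg const_fract_def fract_collapse)
    then show False
      using a by blast
  qed
  let ?B = "Polynomial.degree f + Polynomial.degree g"
  have "t \<le> ?B" if "c \<noteq> 0" "monic_fract a = c ^ t" for c t
  proof (rule ccontr)
    assume t: "\<not> t \<le> ?B"
    obtain r s where c: "c = Fract r s" "s \<noteq> 0"
      by (cases c)
    have "r \<noteq> 0"
      using that(1) c by (auto simp: fract_collapse)
    have "to_fract (monic_part f * s ^ t) = to_fract (monic_part g * r ^ t)"
      using that(2) fg(2) c(2) unfolding fg(1) monic_fract_Fract[OF \<open>f \<noteq> 0\<close> fg(2)] c(1)
      by (simp add: Fract_conv_to_fract to_fract_power field_simps)
    then have "monic_part f * s ^ t = monic_part g * r ^ t"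
      by (simp only: to_fract_eq_iff)
    \<comment> \<open>Coefficients are extended to the algebraic closure, where the passage to a
      coprime pair is stated.\<close>
    then have eq: "poly_ac (monic_part f) * poly_ac s ^ t = poly_ac (monic_part g) * poly_ac r ^ t"
      by (metis const_ac.map_poly_hom_mult const_ac.map_poly_hom_power)
    have "poly_ac r \<noteq> 0" "poly_ac s \<noteq> 0"
      using \<open>r \<noteq> 0\<close> c(2) by simp_all
    then obtain R S where RS: "coprime R S" "R \<noteq> 0" "S \<noteq> 0"
        "poly_ac (monic_part f) * S ^ t = poly_ac (monic_part g) * R ^ t"
      using obtain_coprime_quotient[OF eq] by blast
    have "R ^ t dvd poly_ac (monic_part f) * S ^ t" "S ^ t dvd poly_ac (monic_part g) * R ^ t"
      using RS(4) by (metis dvd_triv_right)+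
    moreover have "coprime (R ^ t) (S ^ t)" "coprime (S ^ t) (R ^ t)"
      using RS(1) by (simp_all add: coprime_commute)
    ultimately have dvd: "R ^ t dvd poly_ac (monic_part f)" "S ^ t dvd poly_ac (monic_part g)"
      by (simp_all only: coprime_dvd_mult_left_iff)
    have "poly_ac (monic_part f) \<noteq> 0" "poly_ac (monic_part g) \<noteq> 0"
      using \<open>f \<noteq> 0\<close> fg(2) by simp_all
    note dvd_imp_degree_le[OF dvd(1) this(1)] dvd_imp_degree_le[OF dvd(2) this(2)]
    then have "t * Polynomial.degree R \<le> ?B" "t * Polynomial.degree S \<le> ?B"
      using RS(2,3) by (simp_all add: degree_power_eq)
    moreover have "m = 0" if "t * m \<le> ?B" for m
      using that t by (cases m) auto
    ultimately have "Polynomial.degree R = 0" "Polynomial.degree S = 0"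
      by blast+
    then obtain u v where uv: "R = [:u:]" "S = [:v:]"
      by (metis degree_eq_zeroE)
    \<comment> \<open>Taking monic parts removes the nonzero constants \<open>R\<close> and
      \<open>S\<close> from the identity.\<close>
    have mR: "monic_part R = 1" and mS: "monic_part S = 1"
      using RS(2,3) uv by (simp_all add: monic_part_def)
    have "monic_part (poly_ac (monic_part f)) = monic_part (poly_ac (monic_part g))"
      using arg_cong[OF RS(4), of monic_part] by (simp add: monic_part_mult monic_part_power mR mS)
    then have "monic_part (monic_part f) = monic_part (monic_part g)"
      by (simp add: const_ac.monic_part_map_poly)
    then have mfg: "monic_part f = monic_part g"
      using monic_part_characterization(1)[OF \<open>f \<noteq> 0\<close>] monic_part_characterization(1)[OF fg(2)]
      by (simp add: monic_part_eq_self del: degree_monic_part)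
    have "a \<noteq> 0"
      using fg \<open>f \<noteq> 0\<close> by (simp add: Fract_conv_to_fract)
    then obtain u where "a = const_fract u * monic_fract a"
      using monic_fract_eq_const_mult by blast
    moreover have "monic_fract a = 1"
      using mfg fg(2) unfolding fg(1) monic_fract_Fract[OF \<open>f \<noteq> 0\<close> fg(2)]
      by (simp add: Fract_conv_to_fract)
    ultimately have "a = const_fract u"
      by simp
    then show False
      using a by blast
  qed
  then show thesis
    using that by blast
qed

text \<open>The bound on the exponents makes the greatest one exist. If \<open>e\<close> is
  admissible, so is its lcm with the greatest exponent, which by maximality is that exponent
  itself.\<close>

lemma power_index:
  fixes a :: "'q::field poly fract"
  assumes "a \<noteq> 0" "a \<notin> range const_fract"
  shows "power_index a > 0" "\<exists>c. c \<noteq> 0 \<and> monic_fract a = c ^ power_index a"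
    "e > 0 \<Longrightarrow> c \<noteq> 0 \<Longrightarrow> monic_fract a = c ^ e \<Longrightarrow> e dvd power_index a"
proof -
  let ?P = "\<lambda>t. t \<ge> 1 \<and> (\<exists>c. c \<noteq> 0 \<and> monic_fract a = c ^ t)"
  obtain B where B: "\<And>t c. c \<noteq> 0 \<Longrightarrow> monic_fract a = c ^ t \<Longrightarrow> t \<le> B"
    using power_exponent_le[OF assms(2)] by blast
  have nz: "monic_fract a \<noteq> 0"
  proof -
    obtain f g where fg: "a = Fract f g" "g \<noteq> 0"
      by (cases a)
    have "f \<noteq> 0"
      using fg assms(1) by (auto simp: fract_collapse)
    then show ?thesis
      unfolding fg(1) monic_fract_Fract[OF \<open>f \<noteq> 0\<close> fg(2)]
      using fg(2) by (simp add: Fract_conv_to_fract)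
  qed
  have "?P 1"
    using nz by auto
  then have h: "?P (power_index a)"
    unfolding power_index_def by (rule GreatestI_nat) (use B in blast)
  have le: "t \<le> power_index a" if "?P t" for t
    unfolding power_index_def using that by (rule Greatest_le_nat) (use B in blast)
  show "power_index a > 0" "\<exists>c. c \<noteq> 0 \<and> monic_fract a = c ^ power_index a"
    using h by auto
  then obtain c' where c': "monic_fract a = c' ^ power_index a" "power_index a > 0"
    by blast
  show "e dvd power_index a" if e: "e > 0" "c \<noteq> 0" "monic_fract a = c ^ e"
  proof -
    obtain w where w: "monic_fract a = w ^ lcm e (power_index a)"
      using power_lcm_if_powers[OF nz e(3) c'(1) e(1) c'(2)] .
    have pos: "lcm e (power_index a) > 0"
      using e(1) c'(2) by (simp add: lcm_pos_nat)
    then have "w \<noteq> 0"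
      using w nz by (auto simp: power_0_left)
    then have "lcm e (power_index a) \<le> power_index a"
      using le[of "lcm e (power_index a)"] pos w by auto
    then have "lcm e (power_index a) = power_index a"
      using dvd_imp_le[OF dvd_lcm2 pos] by (rule antisym)
    then show ?thesis
      by (metis dvd_lcm1)
  qed
qed

text \<open>The powers of \<zeta> with exponents below \<open>n\<close> are distinct, and X^n - 1
  has at most \<open>n\<close> roots.\<close>

lemma root_of_unity_eq_power:
  fixes \<zeta> :: "'a::field"
  assumes "primitive_root_of_unity n \<zeta>" "x ^ n = 1"
  obtains i where "x = \<zeta> ^ i"
proof -
  have n: "n > 0" "\<zeta> ^ n = 1" and prim: "\<And>m. 0 < m \<Longrightarrow> m < n \<Longrightarrow> \<zeta> ^ m \<noteq> 1"
    using assms(1) by (auto simp: primitive_root_of_unity_def)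
  have "\<zeta> \<noteq> 0"
    using n by (auto simp: power_0_left)
  let ?P = "Polynomial.monom 1 n - 1 :: 'a poly"
  have "poly.coeff ?P n = 1"
    using n by simp
  then have "?P \<noteq> 0"
    by (metis coeff_0 zero_neq_one)
  have "Polynomial.degree ?P \<le> n"
    by (intro degree_diff_le) (simp_all add: degree_monom_le)
  then have card: "card {y. poly ?P y = 0} \<le> n"
    using card_poly_roots_bound[OF \<open>?P \<noteq> 0\<close>] by simp
  have roots: "{y. poly ?P y = 0} = {y :: 'a. y ^ n = 1}"
    by (simp add: poly_monom)
  have "inj_on (\<lambda>i. \<zeta> ^ i) {..<n}"
  proof (rule linorder_inj_onI)
    fix i j assume ij: "i < j" "i \<in> {..<n}" "j \<in> {..<n}"
    show "\<zeta> ^ i \<noteq> \<zeta> ^ j"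
    proof
      assume "\<zeta> ^ i = \<zeta> ^ j"
      also have "\<zeta> ^ j = \<zeta> ^ i * \<zeta> ^ (j - i)"
        using ij by (simp flip: power_add)
      finally have "\<zeta> ^ (j - i) = 1"
        using \<open>\<zeta> \<noteq> 0\<close> by simp
      then show False
        using prim[of "j - i"] ij by (simp add: less_imp_diff_less)
    qed
  qed auto
  then have "card ((\<lambda>i. \<zeta> ^ i) ` {..<n}) = n"
    by (simp add: card_image)
  moreover have "(\<lambda>i. \<zeta> ^ i) ` {..<n} \<subseteq> {y. y ^ n = 1}"
  proof safe
    fix i
    have "(\<zeta> ^ i) ^ n = (\<zeta> ^ n) ^ i"
      by (simp only: mult.commute flip: power_mult)
    then show "(\<zeta> ^ i) ^ n = 1"
      by (simp add: n(2))
  qed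
  moreover have "finite {y :: 'a. y ^ n = 1}"
    using poly_roots_finite[OF \<open>?P \<noteq> 0\<close>] unfolding roots .
  ultimately have "(\<lambda>i. \<zeta> ^ i) ` {..<n} = {y. y ^ n = 1}"
    using card unfolding roots by (intro card_seteq) simp_all
  then show thesis
    using assms(2) that by blast
qed

text \<open>
  Every root of the minimal polynomial \<open>P\<close> of \<open>b\<close> is \<open>b\<close> times a root of unity, so the constant
  coefficient of \<open>P\<close> is \<open>b ^ degree P\<close> times a root of unity.
\<close>

lemma kummer_power_mem:
  fixes b :: "'a::alg_closed_field"
  assumes K: "subfield K ring_of_type_algebra" and "b \<noteq> 0"
    and monic: "Polynomial.lead_coeff P = 1" and coeffs: "\<And>i. poly.coeff P i \<in> K"
    and roots: "\<And>y. poly P y = 0 \<Longrightarrow> y \<noteq> 0 \<and> y / b \<in> K"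
  shows "b ^ Polynomial.degree P \<in> K"
proof -
  note closed = subfield_closed[OF K]
  have "P \<noteq> 0"
    using monic by auto
  then obtain A where A: "size A = Polynomial.degree P" "P = (\<Prod>x\<in>#A. [:-x, 1:])"
    using alg_closed_imp_factorization[of P] monic by auto
  have "x \<noteq> 0 \<and> x / b \<in> K" if "x \<in># A" for x
  proof (rule roots)
    show "poly P x = 0"
      unfolding A(2) using that by (auto simp: poly_prod_mset prod_mset_zero_iff)
  qed
  \<comment> \<open>At 0 the linear factor of a root x takes the value -x = -(x / b) * b, so each
    root contributes one factor \<open>b\<close> and an element of \<open>K\<close>.\<close>
  then have "\<exists>\<eta>\<in>K. \<eta> \<noteq> 0 \<and> poly (\<Prod>x\<in>#A. [:-x, 1:]) 0 = \<eta> * b ^ size A"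
  proof (induction A)
    case empty
    then show ?case
      using closed(2) by force
  next
    case (add x A)
    then obtain \<eta> where \<eta>: "\<eta> \<in> K" "\<eta> \<noteq> 0" "poly (\<Prod>x\<in>#A. [:-x, 1:]) 0 = \<eta> * b ^ size A"
      by auto
    have "x / b \<in> K" "x \<noteq> 0"
      using add.prems by auto
    then have "- (x / b * \<eta>) \<in> K" "- (x / b * \<eta>) \<noteq> 0"
      using \<eta>(2) \<open>b \<noteq> 0\<close> by (intro closed(3) closed(5) \<eta>(1), simp_all)
    moreover have "poly (\<Prod>x\<in>#add_mset x A. [:-x, 1:]) 0 = - (x / b * \<eta>) * b ^ size (add_mset x A)"
      using \<eta>(3) \<open>b \<noteq> 0\<close> by simp
    ultimately show ?case
      by blast
  qed
  then obtain \<eta> where \<eta>: "\<eta> \<in> K" "\<eta> \<noteq> 0" "poly P 0 = \<eta> * b ^ Polynomial.degree P"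
    using A by auto
  have "b ^ Polynomial.degree P = poly P 0 / \<eta>"
    using \<eta> by simp
  moreover have "poly P 0 \<in> K"
    using coeffs[of 0] by (simp add: poly_0_coeff_0)
  ultimately show ?thesis
    using closed(8) \<eta>(1) by simp
qed

theorem theorem4p4:
  fixes p q k n d h :: nat
    and a :: "'q::{finite,field} poly fract"
    and \<zeta> b :: "'q poly fract alg_closure"
    and M F :: "'q poly fract alg_closure set"
  assumes "prime p" and "k > 0" and "q = p ^ k" and "card (UNIV :: 'q set) = q"
    and "n > 0" and "d > 0" and "d dvd n" and "\<not> p dvd n"
    and "a \<noteq> 0" and "a \<notin> range const_fract"
    and "h = power_index a"
    and "primitive_root_of_unity n \<zeta>"
    and "b ^ d = to_ac a"
    and "M = adjoin Kq {\<zeta>, b}"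
    and "F = compositum (constant_field M) Kq"
  shows "ring.finite_dimension Kbar F M \<and> ring.dim Kbar F M = d div gcd d h"
proof -
  interpret R: field "Kbar :: 'q poly fract alg_closure ring"
    by (rule field_from_type_algebra)
  interpret finite_constant_field p k "TYPE('q)"
    using assms(1,3,4) by unfold_locales simp_all

  \<comment> \<open>\<open>M\<close> as a simple extension of \<open>F\<close>\<close>
  have M: "subfield M Kbar" and F: "subfield F Kbar"
    unfolding assms adjoin_def compositum_def by (rule subfield_generate_field)+
  have "Kq \<subseteq> M" "\<zeta> \<in> M" "b \<in> M"
    unfolding assms(14) adjoin_def by (auto intro: generate_field.incl)
  have "Kq \<subseteq> F"
    unfolding assms(15) compositum_def by (auto intro: generate_field.incl)
  \<comment> \<open>A root of a constant is itself algebraic over the finite field. This places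
    \<zeta> in \<open>F\<close>, and later the constant part of \<open>b ^ D\<close>.\<close>
  have const_mem: "x \<in> F" if "x \<in> M" "x ^ i \<in> Fq" "i > 0" for x i
  proof -
    have "x \<in> constant_field M"
      using that algebraic_Fq_if_power_mem[of x i] by (simp add: constant_field_def)
    then show ?thesis
      unfolding assms(15) compositum_def by (auto intro: generate_field.incl)
  qed
  have "\<zeta> ^ n = 1"
    using assms(12) by (simp add: primitive_root_of_unity_def)
  then have "\<zeta> \<in> F"
    using \<open>\<zeta> \<in> M\<close> assms(5) subfield_closed(2)[OF subfield_Fq] by (intro const_mem[of \<zeta> n]) simp_all
  have root_mem: "x \<in> F" if "x ^ n = 1" for x
    using root_of_unity_eq_power[OF assms(12) that] \<open>\<zeta> \<in> F\<close> subfield_closed(7)[OF F] by metis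
  have "F \<subseteq> M"
    unfolding assms(15) compositum_def
    using \<open>Kq \<subseteq> M\<close> by (intro generate_field_least[OF M]) (auto simp: constant_field_def)
  have M_eq: "M = generate_field Kbar (F \<union> {b})"
  proof
    show "M \<subseteq> generate_field Kbar (F \<union> {b})"
      unfolding assms(14) adjoin_def
      using \<open>Kq \<subseteq> F\<close> \<open>\<zeta> \<in> F\<close>
      by (intro generate_field_least[OF subfield_generate_field]) (auto intro: generate_field.incl)
    show "generate_field Kbar (F \<union> {b}) \<subseteq> M"
      using \<open>F \<subseteq> M\<close> \<open>b \<in> M\<close> by (intro generate_field_least[OF M]) auto
  qed
  \<comment> \<open>Both kinds of generators of \<open>F\<close>, rational functions and algebraic
    constants, are periodic fractions; so the descent of roots applies to elements of
    \<open>F\<close>.\<close>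
  have F_periodic: "F \<subseteq> periodic_fracts"
    unfolding assms(15) compositum_def
    using Kq_subset_periodic_fracts algebraic_in_periodic_fracts
    by (intro generate_field_least[OF subfield_periodic_fracts]) (auto simp: constant_field_def)
  have "b \<noteq> 0"
    using assms(6,9,13) by (auto simp: power_0_left)
  have h: "h > 0"
    unfolding assms(11) using power_index(1)[OF assms(9,10)] .
  define g where "g = gcd d h"
  define D where "D = d div g"
  have "g > 0"
    using assms(6) by (simp add: g_def)
  have d: "d = D * g"
    by (simp add: D_def g_def)
  then have "D > 0" "D dvd n"
    using assms(6) dvd_trans[OF _ assms(7), of D] by (auto intro: gr0I)

  \<comment> \<open>Upper bound: a power of \<open>b\<close> in \<open>F\<close>\<close>
  have bD: "b ^ D \<in> F"
  proof -
    obtain c where c: "c \<noteq> 0" "monic_fract a = c ^ h"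
      using power_index(2)[OF assms(9,10)] assms(11) by blast
    obtain u where u: "a = const_fract u * monic_fract a"
      using monic_fract_eq_const_mult[OF assms(9)] by blast
    \<comment> \<open>Up to a constant factor, \<open>a\<close> is the \<open>h\<close>-th power of
      \<open>c\<close>. As \<open>c' ^ g\<close> is that power in the closure, the quotient
      \<open>b ^ D / c'\<close> has a constant \<open>g\<close>-th power.\<close>
    define c' where "c' = to_ac c ^ (h div g)"
    have "c' \<in> Kq"
      unfolding c'_def by (rule subfield_closed(7)[OF subfield_Kq]) (simp add: Kq_def)
    have "c' \<noteq> 0"
      using c by (simp add: c'_def)
    have "c' ^ g = to_ac c ^ h"
      by (simp add: c'_def g_def flip: power_mult)
    moreover have "(b ^ D) ^ g = to_ac a"
      using assms(13) by (simp add: d power_mult)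
    moreover have "to_ac a = const_ac u * to_ac c ^ h"
      using arg_cong[OF u, of to_ac] by (simp add: c(2) const_ac_def)
    ultimately have "(b ^ D / c') ^ g = const_ac u"
      using c(1) by (simp add: power_divide)
    then have "(b ^ D / c') ^ g \<in> Fq"
      by (simp add: Fq_altdef)
    moreover have "b ^ D / c' \<in> M"
      using \<open>b \<in> M\<close> \<open>c' \<in> Kq\<close> \<open>Kq \<subseteq> M\<close> by (intro subfield_closed(7,8)[OF M]) auto
    ultimately have "b ^ D / c' \<in> F"
      using \<open>g > 0\<close> const_mem by blast
    then have "b ^ D / c' * c' \<in> F"
      using \<open>c' \<in> Kq\<close> \<open>Kq \<subseteq> F\<close> by (intro subfield_closed(5)[OF F]) auto
    then show ?thesis
      using \<open>c' \<noteq> 0\<close> by simp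
  qed

  \<comment> \<open>The minimal polynomial of \<open>b\<close> over \<open>F\<close>\<close>
  define Q where "Q = Polynomial.monom 1 D - [:b ^ D:]"
  have "poly.coeff Q D = 1"
    using \<open>D > 0\<close> by (simp add: Q_def coeff_pCons split: nat.split)
  then have "Q \<noteq> 0"
    by (metis coeff_0 zero_neq_one)
  have Q_coeffs: "poly.coeff Q i \<in> F" for i
    using bD subfield_closed[OF F] \<open>D > 0\<close> by (auto simp: Q_def coeff_pCons split: nat.split)
  have Q_degree: "Polynomial.degree Q \<le> D"
    unfolding Q_def by (intro degree_diff_le) (simp_all add: degree_monom_le)
  have poly_Q: "poly Q y = y ^ D - b ^ D" for y
    by (simp add: Q_def poly_monom)
  have alg: "R.algebraic F b"
    unfolding algebraic_iff_poly[OF F] using \<open>Q \<noteq> 0\<close> Q_coeffs poly_Q[of b] by auto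
  obtain P where P: "Polynomial.lead_coeff P = 1" "\<forall>i. poly.coeff P i \<in> F" "poly P b = 0"
    "R.dimension (Polynomial.degree P) F M"
    "\<forall>Q. Q \<noteq> 0 \<and> (\<forall>i. poly.coeff Q i \<in> F) \<and> poly Q b = 0 \<longrightarrow>
      Polynomial.degree P \<le> Polynomial.degree Q \<and> (\<forall>y. poly P y = 0 \<longrightarrow> poly Q y = 0)"
    using minimal_polynomial_dimension[OF F alg, folded M_eq] .
  define r where "r = Polynomial.degree P"
  have PQ: "r \<le> Polynomial.degree Q" "\<And>y. poly P y = 0 \<Longrightarrow> poly Q y = 0"
    using P(5) \<open>Q \<noteq> 0\<close> Q_coeffs poly_Q[of b] by (auto simp: r_def)
  have "r > 0"
  proof (rule gr0I)
    assume "r = 0"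
    then obtain x where "P = [:x:]"
      unfolding r_def by (elim degree_eq_zeroE)
    then show False
      using P(1,3) by simp
  qed
  \<comment> \<open>Conjugates of \<open>b\<close> are roots of X^D - b^D, so they differ from
    \<open>b\<close> by \<open>D\<close>-th roots of unity; these lie in \<open>F\<close> because
    \<open>D\<close> divides \<open>n\<close>.\<close>
  have br: "b ^ r \<in> F"
    unfolding r_def
  proof (rule kummer_power_mem[OF F \<open>b \<noteq> 0\<close> P(1) P(2)[rule_format]])
    fix y assume "poly P y = 0"
    then have y: "y ^ D = b ^ D"
      using PQ(2)[of y] by (simp add: poly_Q)
    then have "(y / b) ^ D = 1"
      using \<open>b \<noteq> 0\<close> by (simp add: power_divide)
    then have "(y / b) ^ n = 1"
      using \<open>D dvd n\<close> by (metis dvd_def power_mult power_one)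
    moreover have "y \<noteq> 0"
      using y \<open>b \<noteq> 0\<close> \<open>D > 0\<close> by (auto simp: power_0_left)
    ultimately show "y \<noteq> 0 \<and> y / b \<in> F"
      using root_mem by blast
  qed

  \<comment> \<open>Lower bound: \<open>D\<close> divides the degree\<close>
  define m where "m = gcd r d"
  have "m > 0"
    using \<open>r > 0\<close> by (simp add: m_def)
  obtain e where e: "d = m * e"
    unfolding m_def by (meson dvd_def gcd_dvd2)
  \<comment> \<open>By this identity \<open>b ^ m\<close> is the quotient of a power of
    \<open>b ^ r\<close> by a power of \<open>to_ac a\<close>, both in \<open>F\<close>.\<close>
  obtain x y where xy: "r * x = d * y + m"
    unfolding m_def using bezout_nat[of r d] \<open>r > 0\<close> by auto
  have "to_ac a \<in> F"
    using \<open>Kq \<subseteq> F\<close> by (auto simp: Kq_def)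
  then have "(b ^ r) ^ x / (b ^ d) ^ y \<in> F"
    unfolding assms(13) by (intro subfield_closed(8)[OF F] subfield_closed(7)[OF F, of _ x]
        subfield_closed(7)[OF F, of _ y] br)
  also have "(b ^ r) ^ x / (b ^ d) ^ y = b ^ m"
    using \<open>b \<noteq> 0\<close> by (simp add: xy power_add flip: power_mult)
  finally have "b ^ m \<in> periodic_fracts"
    using F_periodic by blast
  moreover have "to_ac a = (b ^ m) ^ e"
    using assms(13) by (simp add: e power_mult)
  moreover have "e > 0"
    using e assms(6) by (auto intro: gr0I)
  ultimately obtain c where "c \<noteq> 0" "monic_fract a = c ^ e"
    using monic_fract_is_power[OF assms(9)] by blast
  then have "e dvd h"
    unfolding assms(11) using power_index(3)[OF assms(9,10) \<open>e > 0\<close>] by blast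
  \<comment> \<open>Being a divisor of \<open>d\<close> and of \<open>h\<close>, \<open>e\<close>
    divides \<open>g\<close>; cancelling it in m * e = d = D * g exhibits \<open>m\<close> as a
    multiple of \<open>D\<close>.\<close>
  then have "e dvd g"
    unfolding g_def using e by simp
  then obtain j where "g = e * j"
    by blast
  then have "m * e = (D * j) * e"
    using e d \<open>g = e * j\<close> by (metis mult.assoc mult.commute)
  then have "m = D * j"
    using \<open>e > 0\<close> by (metis less_not_refl mult_cancel2)
  then have "D dvd m"
    by simp
  also have "m dvd r"
    by (simp add: m_def)
  finally have "D \<le> r"
    using \<open>r > 0\<close> by (rule dvd_imp_le)
  \<comment> \<open>The opposite inequality comes from X^D - b^D, which vanishes at
    \<open>b\<close>.\<close>
  then have "r = D"
    using PQ(1) Q_degree by simp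
  then have "R.dimension D F M"
    using P(4) by (simp add: r_def)
  then show ?thesis
    using R.finite_dimensionI[of D F M] R.dimI[OF F, of D M] by (simp add: over_def D_def g_def)
qed

end
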